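(* Let $\mu>-1/2$. 1. For all $f_e\in\mathcal{B}^2_{e,\mu}$, the entropy $S_{L^2(\nu_{e,\mu})}(f_e)$ is finite if and only if the $\mu$-deformed energy $E_{e,\mu}(f_e)$ is finite. 2. For all $f_o\in\mathcal{B}^2_{o,\mu}$, the entropy $S_{L^2(\nu_{o,\mu})}(f_o)$ is finite if and only if the $\mu$-deformed energy $E_{o,\mu}(f_o)$ is finite. 3. For all $f\in\mathcal{B}^2_\mu$, the $\mu$-deformed entropy $S_\mu(f)$ is finite if and only if the $\mu$-deformed energy $E_\mu(f)$ is finite.
   Context: Fix $\mu>-1/2$. For $x>0$ and $\alpha\in\mathbf{R}$, $K_\alpha(x)=\int_0^\infty e^{-x\cosh u}\cosh(\alpha u)\,du$ is the Macdonald function. On $\mathbf{C}$ define the finite measures $d\nu_{e,\mu}(z)=\nu_{e,\mu}(z)\,dx\,dy$ and $d\nu_{o,\mu}(z)=\nu_{o,\mu}(z)\,dx\,dy$ with densities, for $z\neq0$, $$\nu_{e,\mu}(z)=\frac{2^{\frac12-\mu}}{\pi\Gamma(\mu+\frac12)}K_{\mu-\frac12}(|z|^2)|z|^{2\mu+1},\qquad \nu_{o,\mu}(z)=\frac{2^{\frac12-\mu}}{\pi\Gamma(\mu+\frac12)}K_{\mu+\frac12}(|z|^2)|z|^{2\mu+1}.$$ For $f:\mathbf{C}\to\mathbf{C}$, $f_e(z)=(f(z)+f(-z))/2$ and $f_o(z)=(f(z)-f(-z))/2$ are its even and odd parts. $\mathcal{B}^2_\mu$ is the space of entire functions $f$ with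 $f_e\in L^2(\mathbf{C},\nu_{e,\mu})$ and $f_o\in L^2(\mathbf{C},\nu_{o,\mu})$; $\mathcal{B}^2_{e,\mu}$ and $\mathcal{B}^2_{o,\mu}$ are its subspaces of even and odd functions. Entropy: for a finite measure space $(\Omega,\nu)$ and $f\in L^2(\Omega,\nu)$, $S_{L^2(\Omega,\nu)}(f)=\int_\Omega|f|^2\log|f|^2\,d\nu-\|f\|^2_{L^2}\log\|f\|^2_{L^2}\in(-\infty,+\infty]$, with $0\log0=0$. Let $\mathbf{Z}_2=\{-1,+1\}$ and let $\nu_\mu$ be the measure on $\mathbf{C}\times\mathbf{Z}_2$ equal to $\nu_{e,\mu}$ on $\mathbf{C}\times\{+1\}$ and to $\nu_{o,\mu}$ on $\mathbf{C}\times\{-1\}$. The $\mu$-deformed entropy of $f\in\mathcal{B}^2_\mu$ is $S_\mu(f)=S_{L^2(\mathbf{C}\times\mathbf{Z}_2,\nu_\mu)}(f_e,f_o)$, where $(f_e,f_o)$ denotes the function equal to $f_e$ on $\mathbf{C}\times\{+1\}$ and to $f_o$ on $\mathbf{C}\times\{-1\}$. $\mu$-deformed energies (values in $[0,+\infty]$): $E_{e,\mu}(g)=\int_{\mathbf{C}}|z|^2|g(z)|^2\,d\nu_{e,\mu}(z)$ for $g\in\mathcal{B}^2_{e,\mu}$, $E_{o,\mu}(h)=\int_{\mathbf{C}}|z|^2|h(z)|^2\,d\nu_{o,\mu}(z)$ for $h\in\mathcal{B}^2_{o,\mu}$, and $E_\mu(f)=E_{e,\mu}(f_e)+E_{o,\mu}(f_o)$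 for $f\in\mathcal{B}^2_\mu$. *)

theory Defs
  imports "HOL-Analysis.Analysis"
begin

text \<open>Macdonald function; only the values at \<^term>\<open>x > 0\<close> are meaningful
  (for \<^term>\<open>x \<le> 0\<close> the integral diverges and the library's integral returns 0).\<close>

definition macdonald_K :: "real \<Rightarrow> real \<Rightarrow> real" where
  "macdonald_K \<alpha> x = (LBINT u:{0..}. exp (- x * cosh u) * cosh (\<alpha> * u))"

definition nu_e_density :: "real \<Rightarrow> complex \<Rightarrow> real" where
  "nu_e_density \<mu> z =
     2 powr (1/2 - \<mu>) / (pi * Gamma (\<mu> + 1/2))
       * macdonald_K (\<mu> - 1/2) ((cmod z)\<^sup>2) * cmod z powr (2 * \<mu> + 1)"

definition nu_o_density :: "real \<Rightarrow> complex \<Rightarrow> real" where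
  "nu_o_density \<mu> z =
     2 powr (1/2 - \<mu>) / (pi * Gamma (\<mu> + 1/2))
       * macdonald_K (\<mu> + 1/2) ((cmod z)\<^sup>2) * cmod z powr (2 * \<mu> + 1)"

text \<open>On the complex numbers, \<^term>\<open>lborel\<close> is the planar Lebesgue measure $dx\,dy$; the
  value of the densities at the single point 0 is irrelevant.\<close>

definition nu_e :: "real \<Rightarrow> complex measure" where
  "nu_e \<mu> = density lborel (\<lambda>z. ennreal (nu_e_density \<mu> z))"

definition nu_o :: "real \<Rightarrow> complex measure" where
  "nu_o \<mu> = density lborel (\<lambda>z. ennreal (nu_o_density \<mu> z))"

definition even_part :: "(complex \<Rightarrow> complex) \<Rightarrow> complex \<Rightarrow> complex" where
  "even_part f z = (f z + f (- z)) / 2"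

definition odd_part :: "(complex \<Rightarrow> complex) \<Rightarrow> complex \<Rightarrow> complex" where
  "odd_part f z = (f z - f (- z)) / 2"

definition L2_space :: "'a measure \<Rightarrow> ('a \<Rightarrow> complex) set" where
  "L2_space M = {f \<in> borel_measurable M. integrable M (\<lambda>x. (cmod (f x))\<^sup>2)}"

definition Bargmann :: "real \<Rightarrow> (complex \<Rightarrow> complex) set" where
  "Bargmann \<mu> = {f. f holomorphic_on UNIV \<and>
     even_part f \<in> L2_space (nu_e \<mu>) \<and> odd_part f \<in> L2_space (nu_o \<mu>)}"

definition Bargmann_e :: "real \<Rightarrow> (complex \<Rightarrow> complex) set" where
  "Bargmann_e \<mu> = {f \<in> Bargmann \<mu>. \<forall>z. f (- z) = f z}"

definition Bargmann_o :: "real \<Rightarrow> (complex \<Rightarrow> complex) set" where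
  "Bargmann_o \<mu> = {f \<in> Bargmann \<mu>. \<forall>z. f (- z) = - f z}"

text \<open>Extended-real Lebesgue integral $\int g^+ - \int g^-$ (\<^term>\<open>ennreal\<close> truncates negative
  numbers to 0). The case $\infty - \infty$ does not arise for the entropy: there
  $g = t \log t \ge -1/e$ with $t = |f|^2$, and the measure is finite, so $\int g^- < \infty$.\<close>

definition ext_integral :: "'a measure \<Rightarrow> ('a \<Rightarrow> real) \<Rightarrow> ereal" where
  "ext_integral M g =
     enn2ereal (\<integral>\<^sup>+x. ennreal (g x) \<partial>M) - enn2ereal (\<integral>\<^sup>+x. ennreal (- g x) \<partial>M)"

text \<open>The convention $0 \log 0 = 0$ is automatic.\<close>

definition L2_entropy :: "'a measure \<Rightarrow> ('a \<Rightarrow> complex) \<Rightarrow> ereal" where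
  "L2_entropy M f =
     ext_integral M (\<lambda>x. (cmod (f x))\<^sup>2 * ln ((cmod (f x))\<^sup>2))
     - ereal ((LINT x|M. (cmod (f x))\<^sup>2) * ln (LINT x|M. (cmod (f x))\<^sup>2))"

definition Z2 :: "int set" where
  "Z2 = {-1, 1}"

definition nu :: "real \<Rightarrow> (complex \<times> int) measure" where
  "nu \<mu> = density (lborel \<Otimes>\<^sub>M count_space Z2)
     (\<lambda>(z, s). ennreal (if s = 1 then nu_e_density \<mu> z else nu_o_density \<mu> z))"

lemma macdonald_K_measurable [measurable]: "macdonald_K \<alpha> \<in> borel_measurable borel"
proof -
  have "(\<lambda>x. LINT u|lborel. indicator {0..} u *\<^sub>R (exp (- x * cosh u) * cosh (\<alpha> * u)))
      \<in> borel_measurable borel"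
    unfolding cosh_def by measurable
  then show ?thesis
    unfolding macdonald_K_def set_lebesgue_integral_def by simp
qed

lemma nu_density_measurable [measurable]:
  "nu_e_density \<mu> \<in> borel_measurable borel" "nu_o_density \<mu> \<in> borel_measurable borel"
  unfolding nu_e_density_def nu_o_density_def by measurable

lemma space_nu: "space (nu \<mu>) = UNIV \<times> {-1, 1}"
  by (simp add: nu_def Z2_def space_pair_measure)

lemma emeasure_nu:
  assumes "A \<in> sets borel"
  shows "emeasure (nu \<mu>) (A \<times> {1}) = emeasure (nu_e \<mu>) A"
    and "emeasure (nu \<mu>) (A \<times> {-1}) = emeasure (nu_o \<mu>) A"
proof -
  interpret C: sigma_finite_measure "count_space Z2"
    by (rule sigma_finite_measure_count_space_finite) (simp add: Z2_def)
  interpret P: pair_sigma_finite "lborel :: complex measure" "count_space Z2" ..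
  have fin: "finite Z2" by (simp add: Z2_def)
  have [measurable]: "(\<lambda>(z, s). ennreal (if s = 1 then nu_e_density \<mu> z else nu_o_density \<mu> z))
      \<in> borel_measurable (lborel \<Otimes>\<^sub>M count_space Z2)"
    by measurable
  have 1: "emeasure (nu \<mu>) (A \<times> {r}) =
      (\<integral>\<^sup>+z. (\<Sum>s\<in>Z2. ennreal (if s = 1 then nu_e_density \<mu> z else nu_o_density \<mu> z)
         * indicator (A \<times> {r}) (z, s)) \<partial>lborel)" if "r \<in> Z2" for r
  proof -
    have [measurable]: "A \<times> {r} \<in> sets (lborel \<Otimes>\<^sub>M count_space Z2)"
      using assms that by simp
    show ?thesis
      unfolding nu_def
      by (simp add: emeasure_density C.nn_integral_fst[symmetric] nn_integral_count_space_finite fin)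
  qed
  show "emeasure (nu \<mu>) (A \<times> {1}) = emeasure (nu_e \<mu>) A"
    using assms by (subst 1) (auto simp: Z2_def nu_e_def emeasure_density indicator_def
        intro!: nn_integral_cong)
  show "emeasure (nu \<mu>) (A \<times> {-1}) = emeasure (nu_o \<mu>) A"
    using assms by (subst 1) (auto simp: Z2_def nu_o_def emeasure_density indicator_def
        intro!: nn_integral_cong)
qed

definition deformed_entropy :: "real \<Rightarrow> (complex \<Rightarrow> complex) \<Rightarrow> ereal" where
  "deformed_entropy \<mu> f =
     L2_entropy (nu \<mu>) (\<lambda>(z, s). if s = 1 then even_part f z else odd_part f z)"

definition energy_e :: "real \<Rightarrow> (complex \<Rightarrow> complex) \<Rightarrow> ennreal" where
  "energy_e \<mu> g = (\<integral>\<^sup>+z. ennreal ((cmod z)\<^sup>2 * (cmod (g z))\<^sup>2) \<partial>nu_e \<mu>)"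

definition energy_o :: "real \<Rightarrow> (complex \<Rightarrow> complex) \<Rightarrow> ennreal" where
  "energy_o \<mu> h = (\<integral>\<^sup>+z. ennreal ((cmod z)\<^sup>2 * (cmod (h z))\<^sup>2) \<partial>nu_o \<mu>)"

definition deformed_energy :: "real \<Rightarrow> (complex \<Rightarrow> complex) \<Rightarrow> ennreal" where
  "deformed_energy \<mu> f = energy_e \<mu> (even_part f) + energy_o \<mu> (odd_part f)"

end

theory Submission
  imports Defs "HOL-Complex_Analysis.Complex_Analysis" "HOL-Probability.Distributions"
begin

text \<open>Let $t = |f|^2$. If the energy is finite, so is the entropy: averaging the sub-mean value
  property of $|f|^2$ over a unit disc and bounding the density below by $c\, e^{-b|z|^2}$ gives
  $t \le e^{A + B|z|^2}$, hence $t \log t \le A t + B |z|^2 t$. Conversely, Young's inequality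
  $st \le t \log t - t + e^s$ with $s = |z|^2/2$ bounds the energy by the entropy plus
  $\int e^{|z|^2/2}\,d\nu$. By Tonelli over the integral representation of the Macdonald function
  and scaling, the latter is a multiple of
  $\int_0^\infty \cosh(\alpha u)\,(\cosh u - \frac12)^{-(\mu + 3/2)}\,du$,
  which converges because $|\alpha| < \mu + 3/2$ for $\alpha = \mu \pm \frac12$.\<close>

section \<open>Rotation invariance of planar Lebesgue measure\<close>

text \<open>Lebesgue measure is determined by its values on open boxes, and since
  \<open>Basis\<close> is {1, \<i>} a box in the plane is the product of two real intervals. This
  opens the way to Tonelli in real and imaginary part.\<close>

lemma lborel_complex_eq_distr:
  "(lborel :: complex measure) = distr (lborel \<Otimes>\<^sub>M lborel) borel (\<lambda>(x, y). Complex x y)"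
proof (rule lborel_eqI)
  fix l u :: complex
  assume le: "\<And>b. b \<in> Basis \<Longrightarrow> l \<bullet> b \<le> u \<bullet> b"
  have meas: "(\<lambda>(x, y). Complex x y) \<in> borel_measurable (lborel \<Otimes>\<^sub>M lborel)"
    unfolding case_prod_beta Complex_eq by measurable
  have "(\<lambda>(x, y). Complex x y) -` box l u \<inter> space (lborel \<Otimes>\<^sub>M lborel)
      = box (Re l) (Re u) \<times> box (Im l) (Im u)"
    by (auto simp: box_def Basis_complex_def space_pair_measure)
  moreover have "Re l \<le> Re u" "Im l \<le> Im u"
    using le[of 1] le[of \<i>] by (auto simp: Basis_complex_def)
  ultimately show "emeasure (distr (lborel \<Otimes>\<^sub>M lborel) borel (\<lambda>(x, y). Complex x y)) (box l u) =
      ennreal (\<Prod>b\<in>Basis. (u - l) \<bullet> b)"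
    using meas
    by (simp add: emeasure_distr lborel.emeasure_pair_measure_Times Basis_complex_def
        ennreal_mult' emeasure_lborel_box_eq)
qed simp

lemma nn_integral_lborel_complex:
  assumes [measurable]: "F \<in> borel_measurable borel"
  shows "(\<integral>\<^sup>+z. F z \<partial>lborel) = (\<integral>\<^sup>+x. \<integral>\<^sup>+y. F (Complex x y) \<partial>lborel \<partial>lborel)"
    and "(\<integral>\<^sup>+z. F z \<partial>lborel) = (\<integral>\<^sup>+y. \<integral>\<^sup>+x. F (Complex x y) \<partial>lborel \<partial>lborel)"
proof -
  have [measurable]: "(\<lambda>(x, y). Complex x y) \<in> borel_measurable (lborel \<Otimes>\<^sub>M lborel)"
    unfolding case_prod_beta Complex_eq by measurable
  have *: "(\<integral>\<^sup>+z. F z \<partial>lborel) = (\<integral>\<^sup>+(x, y). F (Complex x y) \<partial>(lborel \<Otimes>\<^sub>M lborel))"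
    by (subst lborel_complex_eq_distr) (simp add: nn_integral_distr split_beta')
  have [measurable]: "(\<lambda>(x, y). F (Complex x y)) \<in> borel_measurable (lborel \<Otimes>\<^sub>M lborel)"
    unfolding case_prod_beta Complex_eq by measurable
  show "(\<integral>\<^sup>+z. F z \<partial>lborel) = (\<integral>\<^sup>+x. \<integral>\<^sup>+y. F (Complex x y) \<partial>lborel \<partial>lborel)"
    unfolding * by (subst lborel.nn_integral_fst[symmetric]) auto
  show "(\<integral>\<^sup>+z. F z \<partial>lborel) = (\<integral>\<^sup>+y. \<integral>\<^sup>+x. F (Complex x y) \<partial>lborel \<partial>lborel)"
    unfolding * by (subst lborel_pair.nn_integral_snd[symmetric]) auto
qed

text \<open>On each line parallel to its direction a shear is a translation by a constant. With that
  line as the inner Tonelli integral, translation invariance in one dimension suffices; the two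
  shears use the two orders of integration.\<close>

lemma nn_integral_shear:
  fixes p :: real
  assumes [measurable]: "F \<in> borel_measurable borel"
  shows "(\<integral>\<^sup>+z. F (z + of_real (p * Im z)) \<partial>lborel) = (\<integral>\<^sup>+z. F z \<partial>lborel)"
    and "(\<integral>\<^sup>+z. F (z + \<i> * of_real (p * Re z)) \<partial>lborel) = (\<integral>\<^sup>+z. F z \<partial>lborel)"
proof -
  have [measurable]: "(\<lambda>z. F (z + of_real (p * Im z))) \<in> borel_measurable borel"
      "(\<lambda>z. F (z + \<i> * of_real (p * Re z))) \<in> borel_measurable borel"
    by measurable
  have [measurable]: "(\<lambda>x. F (Complex x y)) \<in> borel_measurable borel"
      "(\<lambda>x. F (Complex y x)) \<in> borel_measurable borel" for y
    unfolding Complex_eq by measurable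
  have tr: "(\<integral>\<^sup>+x. g (t + x) \<partial>lborel) = (\<integral>\<^sup>+x. g x \<partial>lborel)"
    if "g \<in> borel_measurable borel" for g :: "real \<Rightarrow> ennreal" and t
    using nn_integral_real_affine[of g 1 t] that by simp
  have "(\<integral>\<^sup>+z. F (z + of_real (p * Im z)) \<partial>lborel)
      = (\<integral>\<^sup>+y. \<integral>\<^sup>+x. F (Complex (p * y + x) y) \<partial>lborel \<partial>lborel)"
    by (subst nn_integral_lborel_complex(2))
       (auto intro!: nn_integral_cong arg_cong[where f=F] simp: complex_eq_iff)
  also have "\<dots> = (\<integral>\<^sup>+y. \<integral>\<^sup>+x. F (Complex x y) \<partial>lborel \<partial>lborel)"
    by (intro nn_integral_cong tr) simp
  finally show "(\<integral>\<^sup>+z. F (z + of_real (p * Im z)) \<partial>lborel) = (\<integral>\<^sup>+z. F z \<partial>lborel)"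
    by (simp add: nn_integral_lborel_complex(2))
  have "(\<integral>\<^sup>+z. F (z + \<i> * of_real (p * Re z)) \<partial>lborel)
      = (\<integral>\<^sup>+x. \<integral>\<^sup>+y. F (Complex x (p * x + y)) \<partial>lborel \<partial>lborel)"
    by (subst nn_integral_lborel_complex(1))
       (auto intro!: nn_integral_cong arg_cong[where f=F] simp: complex_eq_iff)
  also have "\<dots> = (\<integral>\<^sup>+x. \<integral>\<^sup>+y. F (Complex x y) \<partial>lborel \<partial>lborel)"
    by (intro nn_integral_cong tr) simp
  finally show "(\<integral>\<^sup>+z. F (z + \<i> * of_real (p * Re z)) \<partial>lborel) = (\<integral>\<^sup>+z. F z \<partial>lborel)"
    by (simp add: nn_integral_lborel_complex(1))
qed

text \<open>A rotation that is not \<open>\<plusminus>1\<close> is a product of three shears, and \<open>-1 = \<i> * \<i>\<close>.\<close>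

lemma nn_integral_rotation:
  fixes c :: complex
  assumes F: "F \<in> borel_measurable borel" and c: "cmod c = 1"
  shows "(\<integral>\<^sup>+z. F (c * z) \<partial>lborel) = (\<integral>\<^sup>+z. F z \<partial>lborel)"
proof -
  have gen: "(\<integral>\<^sup>+z. F (c * z) \<partial>lborel) = (\<integral>\<^sup>+z. F z \<partial>lborel)"
    if F[measurable]: "F \<in> borel_measurable borel" and c: "cmod c = 1" "Im c \<noteq> 0"
    for F :: "complex \<Rightarrow> ennreal" and c
  proof -
    \<comment> \<open>For c = e^(i \<theta>), p is -tan(\<theta>/2) and b is sin \<theta>. The
      matrix of the composite \<open>S p\<close>, \<open>T\<close>, \<open>S p\<close> has diagonal
      entries 1 + b p, lower entry b and upper entry p (2 + b p), so it is multiplication by c once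
      b p = Re c - 1 and p (1 + Re c) = -b.\<close>
    define p where "p = (Re c - 1) / Im c"
    define b where "b = Im c"
    define S where "S = (\<lambda>q z. z + complex_of_real (q * Im z))"
    define T where "T = (\<lambda>z. z + \<i> * complex_of_real (b * Re z))"
    have [measurable]: "S q \<in> borel_measurable borel" "T \<in> borel_measurable borel" for q
      unfolding S_def T_def by measurable
    have bp: "b * p = Re c - 1" using c by (simp add: p_def b_def)
    have "(Re c)\<^sup>2 + b\<^sup>2 = 1"
      using c(1) by (simp add: b_def cmod_def)
    then have "p * (1 + Re c) = - b"
      using c(2) by (simp add: p_def b_def field_simps power2_eq_square)
    then have eq: "S p (T (S p z)) = c * z" for z
      using bp unfolding S_def T_def complex_eq_iff b_def
      by (simp, algebra)
    have "(\<integral>\<^sup>+z. F (c * z) \<partial>lborel) = (\<integral>\<^sup>+z. F (S p (T (S p z))) \<partial>lborel)"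
      by (simp add: eq)
    also have "\<dots> = (\<integral>\<^sup>+z. F (S p (T z)) \<partial>lborel)"
      using nn_integral_shear(1)[of "\<lambda>z. F (S p (T z))" p] by (simp add: S_def)
    also have "\<dots> = (\<integral>\<^sup>+z. F (S p z) \<partial>lborel)"
      using nn_integral_shear(2)[of "\<lambda>z. F (S p z)" b] by (simp add: T_def)
    also have "\<dots> = (\<integral>\<^sup>+z. F z \<partial>lborel)"
      using nn_integral_shear(1)[of F p] by (simp add: S_def)
    finally show ?thesis .
  qed
  show ?thesis
  proof (cases "Im c = 0")
    case False
    then show ?thesis using gen[OF F c] by simp
  next
    case True
    with c have "\<bar>Re c\<bar> = 1" by (simp add: cmod_def)
    with True have "c = 1 \<or> c = -1" by (auto simp: complex_eq_iff abs_if split: if_splits)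
    then show ?thesis
    proof
      assume "c = -1"
      moreover have "(\<lambda>z. F (\<i> * z)) \<in> borel_measurable borel"
        using F by measurable
      ultimately show ?thesis
        using gen[of "\<lambda>z. F (\<i> * z)" \<i>] gen[of F \<i>] F by (simp flip: mult.assoc)
    qed simp
  qed
qed


section \<open>Pointwise bounds for square-integrable entire functions\<close>

text \<open>Cauchy's formula on the unit circle for \<zeta> -> g (w \<zeta>): the derivative of the
  parametrization cancels the kernel 1/\<zeta>. Putting w into the function rather than into the
  radius treats all circles, and w = 0, alike.\<close>

lemma mean_value_circle:
  assumes "g holomorphic_on UNIV"
  shows "((\<lambda>x. g (w * cis (2 * pi * x))) has_integral g 0) {0..1}"
proof -
  define h where "h = (\<lambda>\<zeta>. g (w * \<zeta>))"
  have h: "h holomorphic_on UNIV"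
    unfolding h_def
    by (rule holomorphic_on_compose[of "\<lambda>\<zeta>. w * \<zeta>" UNIV g, unfolded o_def])
       (auto intro!: holomorphic_intros holomorphic_on_subset[OF assms])
  have "((\<lambda>u. h u / (u - 0)) has_contour_integral 2 * of_real pi * \<i> * h 0) (circlepath 0 1)"
    by (rule Cauchy_integral_circlepath)
       (auto intro: holomorphic_on_imp_continuous_on holomorphic_on_subset[OF h])
  then have "((\<lambda>x. 2 * of_real pi * \<i> * h (cis (2 * pi * x))) has_integral 2 * of_real pi * \<i> * h 0) {0..1}"
    unfolding has_contour_integral_def
  proof (rule has_integral_eq[rotated])
    fix x :: real assume "x \<in> {0..1}"
    then have "vector_derivative (circlepath 0 1) (at x within {0..1})
        = 2 * pi * \<i> * exp (2 * of_real pi * \<i> * x)"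
      by (simp add: vector_derivative_circlepath01)
    then show "h (circlepath 0 1 x) / (circlepath 0 1 x - 0) *
        vector_derivative (circlepath 0 1) (at x within {0..1})
        = 2 * of_real pi * \<i> * h (cis (2 * pi * x))"
      by (simp add: circlepath cis_conv_exp mult_ac)
  qed
  from has_integral_mult_right[OF this, of "inverse (2 * pi * \<i>)"]
  have "((\<lambda>x. h (cis (2 * pi * x))) has_integral h 0) {0..1}"
    by (simp add: field_simps)
  then show ?thesis by (simp add: h_def)
qed

text \<open>The modulus passes under the mean value integral. The form as an integral in
  [0, \<infinity>] prepares the use of Tonelli in the area version.\<close>

lemma norm_le_circle_mean:
  assumes "g holomorphic_on UNIV"
  shows "ennreal (cmod (g 0))
    \<le> (\<integral>\<^sup>+x. ennreal (cmod (g (w * cis (2 * pi * x)))) * indicator {0..1} x \<partial>lborel)"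
proof -
  have cont: "continuous_on {0..1} (\<lambda>x. g (w * cis (2 * pi * x)))"
    unfolding cis_conv_exp
    by (rule continuous_on_compose2[OF holomorphic_on_imp_continuous_on[OF assms]])
       (auto intro!: continuous_intros)
  have intg: "(\<lambda>x. cmod (g (w * cis (2 * pi * x)))) integrable_on {0..1}"
    by (intro integrable_continuous_interval continuous_on_norm cont)
  have "cmod (g 0) \<le> integral {0..1} (\<lambda>x. cmod (g (w * cis (2 * pi * x))))"
    using mean_value_circle[OF assms, of w] intg
    by (metis (no_types, lifting) integral_norm_bound_integral has_integral_integrable
        integral_unique order_refl)
  also have "ennreal \<dots> = (\<integral>\<^sup>+x. ennreal (cmod (g (w * cis (2 * pi * x)))) * indicator {0..1} x \<partial>lborel)"
  proof -
    have "((\<lambda>x. cmod (g (w * cis (2 * pi * x))) * indicator {0..1} x) has_integral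
        integral {0..1} (\<lambda>x. cmod (g (w * cis (2 * pi * x))))) UNIV"
      using has_integral_restrict_UNIV[of "{0..1}" "\<lambda>x. cmod (g (w * cis (2 * pi * x)))"]
        integrable_integral[OF intg]
      by (auto simp: indicator_def of_bool_def if_distrib cong: if_cong)
    moreover have "(\<lambda>x. cmod (g (w * cis (2 * pi * x))) * indicator {0..1} x) \<in> borel_measurable borel"
      using borel_measurable_continuous_on_indicator[OF _ continuous_on_norm[OF cont]]
      by (simp add: mult.commute)
    ultimately show ?thesis
      by (subst nn_integral_has_integral_lborel[symmetric])
         (auto simp: ennreal_mult' intro!: nn_integral_cong split: split_indicator)
  qed
  finally show ?thesis by (simp add: ennreal_leI)
qed

lemma ball_translate_indicator: "indicator (ball 0 r) w = (indicator (ball z r) (z + w) :: ennreal)"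
  for w :: complex
  by (auto simp: indicator_def dist_norm)

text \<open>The square of w -> f (z + w) is entire with modulus |f (z + w)|^2, so the circle
  inequality bounds |f z|^2. It is then integrated over w in the unit disc, with rotation invariance
  in place of polar coordinates.\<close>

lemma area_mean_value_ineq:
  assumes f: "f holomorphic_on UNIV"
  shows "ennreal ((cmod (f z))\<^sup>2) * emeasure lborel (ball (0::complex) 1)
    \<le> (\<integral>\<^sup>+w. ennreal ((cmod (f w))\<^sup>2) * indicator (ball z 1) w \<partial>lborel)"
proof -
  define g where "g = (\<lambda>w. (f (z + w))\<^sup>2)"
  have "(\<lambda>w. f (z + w)) holomorphic_on UNIV"
    by (rule holomorphic_on_compose[of "\<lambda>w. z + w" UNIV f, unfolded o_def])
       (auto intro!: holomorphic_intros holomorphic_on_subset[OF f])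
  then have g: "g holomorphic_on UNIV"
    unfolding g_def by (intro holomorphic_intros)
  have [measurable]: "g \<in> borel_measurable borel" "f \<in> borel_measurable borel"
    using g f by (auto intro!: borel_measurable_continuous_onI holomorphic_on_imp_continuous_on)
  have [measurable]: "cis \<in> borel_measurable borel"
    unfolding cis_conv_exp by measurable
  \<comment> \<open>The indicator of the disc is built into \<open>G\<close>: rotating w does not
    change it, so it may be taken at the rotated point.\<close>
  define G where "G = (\<lambda>w. ennreal (cmod (g w)) * indicator (ball 0 1) w)"
  have [measurable]: "G \<in> borel_measurable borel"
    unfolding G_def by (intro borel_measurable_times_ennreal borel_measurable_indicator) auto
  have "ennreal (cmod (g 0)) * emeasure lborel (ball (0::complex) 1)
      = (\<integral>\<^sup>+w. ennreal (cmod (g 0)) * indicator (ball (0::complex) 1) w \<partial>lborel)"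
    by (simp add: nn_integral_cmult_indicator)
  also have "\<dots> \<le> (\<integral>\<^sup>+w. (\<integral>\<^sup>+x. G (cis (2 * pi * x) * w) * indicator {0..1} x \<partial>lborel) \<partial>lborel)"
  proof (rule nn_integral_mono)
    fix w :: complex
    have "ennreal (cmod (g 0)) * indicator (ball (0::complex) 1) w
       \<le> (\<integral>\<^sup>+x. ennreal (cmod (g (w * cis (2 * pi * x)))) * indicator {0..1} x \<partial>lborel)
          * indicator (ball (0::complex) 1) w"
      by (intro mult_right_mono norm_le_circle_mean g) auto
    also have "\<dots> = (\<integral>\<^sup>+x. ennreal (cmod (g (w * cis (2 * pi * x)))) * indicator {0..1} x
          * indicator (ball (0::complex) 1) w \<partial>lborel)"
      by (rule nn_integral_multc[symmetric]) measurable
    also have "\<dots> = (\<integral>\<^sup>+x. G (cis (2 * pi * x) * w) * indicator {0..1} x \<partial>lborel)"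
      by (intro nn_integral_cong) (auto simp: G_def indicator_def norm_mult mult_ac)
    finally show "ennreal (cmod (g 0)) * indicator (ball (0::complex) 1) w \<le> \<dots>" .
  qed
  also have "\<dots> = (\<integral>\<^sup>+x. (\<integral>\<^sup>+w. G (cis (2 * pi * x) * w) * indicator {0..1} x \<partial>lborel) \<partial>lborel)"
    by (rule lborel_pair.Fubini') measurable
  \<comment> \<open>The inner integral is the same for every angle, so averaging over x in [0, 1]
    returns it.\<close>
  also have "\<dots> = (\<integral>\<^sup>+x. (\<integral>\<^sup>+w. G w \<partial>lborel) * indicator {0..1::real} x \<partial>lborel)"
    by (intro nn_integral_cong) (simp add: nn_integral_multc nn_integral_rotation[of G])
  also have "\<dots> = (\<integral>\<^sup>+w. G w \<partial>lborel)"
    by (simp add: nn_integral_cmult)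
  also have "\<dots> = (\<integral>\<^sup>+w. ennreal ((cmod (f (z + w)))\<^sup>2) * indicator (ball z 1) (z + w) \<partial>lborel)"
    by (simp add: G_def g_def norm_power ball_translate_indicator[of 1 _ z])
  also have "\<dots> = (\<integral>\<^sup>+w. ennreal ((cmod (f w))\<^sup>2) * indicator (ball z 1) w \<partial>distr lborel borel ((+) z))"
    by (subst nn_integral_distr)
       (auto intro!: borel_measurable_times_ennreal borel_measurable_indicator)
  finally show ?thesis
    by (simp add: lborel_distr_plus g_def norm_power)
qed

text \<open>On the unit disc around z the lower bound on \<rho> turns the weighted norm into an
  unweighted one, at the cost of a factor of order e^(2 b |z|^2); the area inequality then bounds |f
  z|^2. Since \<rho> is controlled only for |w| \<ge> 1, this needs |z| \<ge> 2, and compactness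
  covers the remaining disc.\<close>

lemma entire_growth_bound:
  fixes \<rho> :: "complex \<Rightarrow> real"
  assumes f: "f holomorphic_on UNIV"
    and fin: "(\<integral>\<^sup>+w. ennreal (\<rho> w) * ennreal ((cmod (f w))\<^sup>2) \<partial>lborel) < \<infinity>"
    and [measurable]: "\<rho> \<in> borel_measurable borel"
    and c: "c > 0" and b: "b \<ge> 0"
    and low: "\<And>w. cmod w \<ge> 1 \<Longrightarrow> \<rho> w \<ge> c * exp (- b * (cmod w)\<^sup>2)"
  shows "\<exists>A\<ge>0. \<exists>B\<ge>0. \<forall>z. (cmod (f z))\<^sup>2 \<le> exp (A + B * (cmod z)\<^sup>2)"
proof -
  have [measurable]: "f \<in> borel_measurable borel"
    using f by (auto intro!: borel_measurable_continuous_onI holomorphic_on_imp_continuous_on)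
  obtain I where I: "I \<ge> 0"
    "(\<integral>\<^sup>+w. ennreal (\<rho> w) * ennreal ((cmod (f w))\<^sup>2) \<partial>lborel) = ennreal I"
    using fin by (cases "\<integral>\<^sup>+w. ennreal (\<rho> w) * ennreal ((cmod (f w))\<^sup>2) \<partial>lborel") auto
  define V where "V = measure lborel (ball (0::complex) 1)"
  have V: "emeasure lborel (ball (0::complex) 1) = ennreal V"
    unfolding V_def using emeasure_lborel_ball_finite[of "0::complex" 1]
    by (intro emeasure_eq_ennreal_measure) auto
  have Vpos: "V > 0"
    unfolding V_def using content_ball_pos[of 1 "0::complex"] by simp
  have far: "(cmod (f z))\<^sup>2 \<le> I / (V * c) * exp (2 * b) * exp (2 * b * (cmod z)\<^sup>2)" if z: "cmod z \<ge> 2" for z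
  proof -
    \<comment> \<open>For w in the disc |w|^2 \<le> (|z| + 1)^2 \<le> 2 |z|^2 + 2; D is the
      reciprocal of the resulting lower bound c e^(-b (2 |z|^2 + 2)) of \<rho>.\<close>
    define D where "D = exp (2 * b + 2 * b * (cmod z)\<^sup>2) / c"
    have D: "D > 0" using c by (simp add: D_def)
    have pt: "1 \<le> D * \<rho> w" if "w \<in> ball z 1" for w
    proof -
      have d: "cmod (z - w) < 1" using that by (simp add: dist_norm)
      have w1: "cmod w \<ge> 1"
        using norm_triangle_ineq2[of z w] d z by linarith
      have "cmod w \<le> cmod z + 1"
        using norm_triangle_ineq2[of w z] d by (simp add: norm_minus_commute)
      then have "(cmod w)\<^sup>2 \<le> (cmod z + 1)\<^sup>2" by (intro power_mono) auto
      also have "\<dots> \<le> 2 * (cmod z)\<^sup>2 + 2"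
        using zero_le_power2[of "cmod z - 1"] by (simp add: power2_eq_square algebra_simps)
      finally have "b * (cmod w)\<^sup>2 \<le> b * (2 * (cmod z)\<^sup>2 + 2)"
        using b by (rule mult_left_mono)
      then have "exp 0 \<le> exp (2 * b + 2 * b * (cmod z)\<^sup>2) * exp (- b * (cmod w)\<^sup>2)"
        unfolding exp_add[symmetric] by (subst exp_le_cancel_iff) (simp add: algebra_simps)
      also have "\<dots> = D * (c * exp (- b * (cmod w)\<^sup>2))"
        using c by (simp add: D_def)
      also have "\<dots> \<le> D * \<rho> w"
        using D low[OF w1] by (intro mult_left_mono) auto
      finally show ?thesis by simp
    qed
    have "ennreal ((cmod (f z))\<^sup>2 * V) = ennreal ((cmod (f z))\<^sup>2) * ennreal V"
      by (simp add: ennreal_mult')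
    also have "\<dots> \<le> (\<integral>\<^sup>+w. ennreal ((cmod (f w))\<^sup>2) * indicator (ball z 1) w \<partial>lborel)"
      using area_mean_value_ineq[OF f, of z] V by simp
    also have "\<dots> \<le> (\<integral>\<^sup>+w. ennreal D * (ennreal (\<rho> w) * ennreal ((cmod (f w))\<^sup>2)) \<partial>lborel)"
    proof (rule nn_integral_mono)
      fix w
      show "ennreal ((cmod (f w))\<^sup>2) * indicator (ball z 1) w
          \<le> ennreal D * (ennreal (\<rho> w) * ennreal ((cmod (f w))\<^sup>2))"
      proof (cases "w \<in> ball z 1")
        case True
        have "ennreal 1 \<le> ennreal (D * \<rho> w)"
          using pt[OF True] by (rule ennreal_leI)
        then have "1 \<le> ennreal D * ennreal (\<rho> w)"
          using D by (simp add: ennreal_mult')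
        from mult_right_mono[OF this, of "ennreal ((cmod (f w))\<^sup>2)"] True show ?thesis
          by (simp add: mult.assoc)
      qed simp
    qed
    also have "\<dots> = ennreal (D * I)"
      using I D by (simp add: nn_integral_cmult ennreal_mult')
    finally have "(cmod (f z))\<^sup>2 * V \<le> D * I"
      using D I by (simp add: ennreal_le_iff)
    then show ?thesis
      using Vpos c by (simp add: D_def field_simps exp_add)
  qed
  have "compact (f ` cball 0 2)"
    by (intro compact_continuous_image holomorphic_on_imp_continuous_on
        holomorphic_on_subset[OF f]) auto
  then obtain M where M: "\<And>z. cmod z \<le> 2 \<Longrightarrow> cmod (f z) \<le> M"
    by (metis (no_types, lifting) bounded_iff compact_imp_bounded imageI mem_cball_0)
  \<comment> \<open>Q dominates the constants of the near and the far case; the summand 1 makes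
    \<open>ln Q\<close> nonnegative, as the witness A has to be.\<close>
  define Q where "Q = 1 + M\<^sup>2 + I / (V * c) * exp (2 * b)"
  have Q: "Q \<ge> 1" using I Vpos c by (simp add: Q_def)
  have "(cmod (f z))\<^sup>2 \<le> exp (ln Q + 2 * b * (cmod z)\<^sup>2)" for z
  proof -
    have e1: "1 \<le> exp (2 * b * (cmod z)\<^sup>2)" using b by simp
    have "(cmod (f z))\<^sup>2 \<le> Q * exp (2 * b * (cmod z)\<^sup>2)"
    proof (cases "cmod z \<le> 2")
      case True
      then have "(cmod (f z))\<^sup>2 \<le> M\<^sup>2"
        using M by (intro power_mono) auto
      also have "\<dots> \<le> Q * 1" using I Vpos c by (simp add: Q_def)
      also have "\<dots> \<le> Q * exp (2 * b * (cmod z)\<^sup>2)"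
        using Q e1 by (intro mult_left_mono) auto
      finally show ?thesis .
    next
      case False
      then have "(cmod (f z))\<^sup>2 \<le> I / (V * c) * exp (2 * b) * exp (2 * b * (cmod z)\<^sup>2)"
        using far by simp
      also have "\<dots> \<le> Q * exp (2 * b * (cmod z)\<^sup>2)"
        by (intro mult_right_mono) (auto simp: Q_def)
      finally show ?thesis .
    qed
    then show ?thesis using Q by (simp add: exp_add)
  qed
  then show ?thesis
    using Q b by (intro exI[of _ "ln Q"] conjI exI[of _ "2 * b"]) auto
qed


section \<open>Entropy against energy\<close>

text \<open>The functions s ln s - s and exp are Legendre conjugates: multiply 1 + x \<le> exp x at
  x = t - ln s by s. For s = 0 the claim is 0 \<le> exp t.\<close>

lemma young_entropy:
  fixes s t :: real
  assumes "s \<ge> 0"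
  shows "s * t \<le> s * ln s - s + exp t"
proof (cases "s = 0")
  case False
  with assms have s: "s > 0" by simp
  have "s * (1 + (t - ln s)) \<le> s * exp (t - ln s)"
    using s by (intro mult_left_mono exp_ge_add_one_self) auto
  also have "\<dots> = exp t" using s by (simp add: exp_diff)
  finally show ?thesis by (simp add: algebra_simps)
qed simp

text \<open>The comparison for a general weight. \<open>ennreal\<close> truncates at 0, so the first
  claim controls the negative part of t ln t and the second compares its positive part with the
  energy; \<rho> enters only through \<open>low\<close> (growth of f) and \<open>expo\<close>
  (Young).\<close>

lemma entropy_energy_iff:
  fixes \<rho> :: "complex \<Rightarrow> real"
  defines "M \<equiv> density lborel (\<lambda>z. ennreal (\<rho> z))"
  assumes f: "f holomorphic_on UNIV"
    and L2: "integrable M (\<lambda>z. (cmod (f z))\<^sup>2)"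
    and \<rho>[measurable]: "\<rho> \<in> borel_measurable borel"
    and c: "c > 0" and b: "b \<ge> 0"
    and low: "\<And>w. cmod w \<ge> 1 \<Longrightarrow> \<rho> w \<ge> c * exp (- b * (cmod w)\<^sup>2)"
    and expo: "(\<integral>\<^sup>+z. ennreal (exp ((cmod z)\<^sup>2 / 2)) \<partial>M) < \<infinity>"
  shows "(\<integral>\<^sup>+z. ennreal (- ((cmod (f z))\<^sup>2 * ln ((cmod (f z))\<^sup>2))) \<partial>M) < \<infinity>"
    and "(\<integral>\<^sup>+z. ennreal ((cmod (f z))\<^sup>2 * ln ((cmod (f z))\<^sup>2)) \<partial>M) < \<infinity>
      \<longleftrightarrow> (\<integral>\<^sup>+z. ennreal ((cmod z)\<^sup>2 * (cmod (f z))\<^sup>2) \<partial>M) < \<infinity>"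
proof -
  have [measurable]: "f \<in> borel_measurable borel"
    using f by (auto intro!: borel_measurable_continuous_onI holomorphic_on_imp_continuous_on)
  have [measurable_cong]: "sets M = sets borel" by (simp add: M_def)
  define t where "t = (\<lambda>z. (cmod (f z))\<^sup>2)"
  have t0: "t z \<ge> 0" for z by (simp add: t_def)
  have [measurable]: "t \<in> borel_measurable borel" unfolding t_def by measurable
  have young: "t z * s \<le> t z * ln (t z) + exp s" for z s
    using young_entropy[OF t0, of z s] t0[of z] by linarith
  \<comment> \<open>Young's inequality at exponent 0 gives -t ln t \<le> 1, and the constant 1 lies
    below the exponential whose integral is finite by \<open>expo\<close>.\<close>
  have "ennreal (- (t z * ln (t z))) \<le> ennreal (exp ((cmod z)\<^sup>2 / 2))" for z
  proof (rule ennreal_leI)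
    have "1 \<le> exp ((cmod z)\<^sup>2 / 2)" by simp
    then show "- (t z * ln (t z)) \<le> exp ((cmod z)\<^sup>2 / 2)"
      using young[of z 0] by (simp del: one_le_exp_iff)
  qed
  then have "(\<integral>\<^sup>+z. ennreal (- (t z * ln (t z))) \<partial>M) \<le> (\<integral>\<^sup>+z. ennreal (exp ((cmod z)\<^sup>2 / 2)) \<partial>M)"
    by (intro nn_integral_mono)
  with expo show "(\<integral>\<^sup>+z. ennreal (- ((cmod (f z))\<^sup>2 * ln ((cmod (f z))\<^sup>2))) \<partial>M) < \<infinity>"
    by (auto simp: t_def)
  have tfin: "(\<integral>\<^sup>+z. ennreal (t z) \<partial>M) < \<infinity>"
    using L2 unfolding integrable_iff_bounded t_def by simp
  have "(\<integral>\<^sup>+w. ennreal (\<rho> w) * ennreal ((cmod (f w))\<^sup>2) \<partial>lborel) < \<infinity>"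
    using tfin by (simp add: M_def t_def nn_integral_density)
  from entire_growth_bound[OF f this \<rho> c b low]
  obtain A B where AB: "A \<ge> 0" "B \<ge> 0" "\<And>z. t z \<le> exp (A + B * (cmod z)\<^sup>2)"
    unfolding t_def by blast
  have P_le: "t z * ln (t z) \<le> A * t z + B * ((cmod z)\<^sup>2 * t z)" for z
  proof (cases "t z = 0")
    case False
    then have "ln (t z) \<le> ln (exp (A + B * (cmod z)\<^sup>2))"
      using AB(3)[of z] t0[of z] by (subst ln_le_cancel_iff) auto
    then have "ln (t z) \<le> A + B * (cmod z)\<^sup>2" by simp
    from mult_left_mono[OF this t0[of z]] show ?thesis by (simp add: algebra_simps)
  qed simp
  have "(\<integral>\<^sup>+z. ennreal (t z * ln (t z)) \<partial>M) < \<infinity>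
      \<longleftrightarrow> (\<integral>\<^sup>+z. ennreal ((cmod z)\<^sup>2 * t z) \<partial>M) < \<infinity>"
  proof
    assume fin: "(\<integral>\<^sup>+z. ennreal (t z * ln (t z)) \<partial>M) < \<infinity>"
    have "(\<integral>\<^sup>+z. ennreal ((cmod z)\<^sup>2 * t z) \<partial>M)
        \<le> (\<integral>\<^sup>+z. 2 * (ennreal (t z * ln (t z)) + ennreal (exp ((cmod z)\<^sup>2 / 2))) \<partial>M)"
    proof (rule nn_integral_mono)
      fix z
      \<comment> \<open>Young's inequality at exponent |z|^2 / 2, doubled. The maximum with 0 is
        what \<open>ennreal\<close> makes of t ln t, and it makes both summands nonnegative so that
        the sum can be split.\<close>
      have "(cmod z)\<^sup>2 * t z \<le> 2 * (max 0 (t z * ln (t z)) + exp ((cmod z)\<^sup>2 / 2))"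
        using young[of z "(cmod z)\<^sup>2 / 2"] by (simp add: mult_ac)
      then have "ennreal ((cmod z)\<^sup>2 * t z)
          \<le> ennreal (2 * (max 0 (t z * ln (t z)) + exp ((cmod z)\<^sup>2 / 2)))"
        by (rule ennreal_leI)
      also have "\<dots> = ennreal 2 * (ennreal (max 0 (t z * ln (t z))) + ennreal (exp ((cmod z)\<^sup>2 / 2)))"
        by (subst ennreal_mult', simp, subst ennreal_plus) simp_all
      finally show "ennreal ((cmod z)\<^sup>2 * t z) \<le> 2 * (ennreal (t z * ln (t z)) + ennreal (exp ((cmod z)\<^sup>2 / 2)))"
        by (auto simp: max_def ennreal_neg split: if_splits)
    qed
    also have "\<dots> < \<infinity>"
      using fin expo
      by (simp add: nn_integral_cmult nn_integral_add ennreal_mult_less_top)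
    finally show "(\<integral>\<^sup>+z. ennreal ((cmod z)\<^sup>2 * t z) \<partial>M) < \<infinity>" .
  next
    assume fin: "(\<integral>\<^sup>+z. ennreal ((cmod z)\<^sup>2 * t z) \<partial>M) < \<infinity>"
    \<comment> \<open>Because A and B are nonnegative, \<open>P_le\<close> carries over to
      \<open>ennreal\<close> term by term; the A-term is finite by square integrability, the B-term
      by finite energy.\<close>
    have "(\<integral>\<^sup>+z. ennreal (t z * ln (t z)) \<partial>M)
        \<le> (\<integral>\<^sup>+z. ennreal A * ennreal (t z) + ennreal B * ennreal ((cmod z)\<^sup>2 * t z) \<partial>M)"
      using AB t0 ennreal_leI[OF P_le]
      by (intro nn_integral_mono) (simp add: ennreal_mult' ennreal_plus)
    also have "\<dots> < \<infinity>"
      using fin tfin by (simp add: nn_integral_cmult nn_integral_add ennreal_mult_less_top)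
    finally show "(\<integral>\<^sup>+z. ennreal (t z * ln (t z)) \<partial>M) < \<infinity>" .
  qed
  then show "(\<integral>\<^sup>+z. ennreal ((cmod (f z))\<^sup>2 * ln ((cmod (f z))\<^sup>2)) \<partial>M) < \<infinity>
      \<longleftrightarrow> (\<integral>\<^sup>+z. ennreal ((cmod z)\<^sup>2 * (cmod (f z))\<^sup>2) \<partial>M) < \<infinity>"
    by (simp only: t_def)
qed

section \<open>Entropy as an extended real, and integration over the doubled plane\<close>

lemma L2_entropy_finite_iff:
  assumes "(\<integral>\<^sup>+x. ennreal (- ((cmod (f x))\<^sup>2 * ln ((cmod (f x))\<^sup>2))) \<partial>M) < \<infinity>"
  shows "\<bar>L2_entropy M f\<bar> \<noteq> \<infinity> \<longleftrightarrow> (\<integral>\<^sup>+x. ennreal ((cmod (f x))\<^sup>2 * ln ((cmod (f x))\<^sup>2)) \<partial>M) < \<infinity>"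
  \<comment> \<open>The norm term is a real number, so with a finite negative part only the positive
    part can make the entropy infinite.\<close>
  using assms unfolding L2_entropy_def ext_integral_def
  by (cases "\<integral>\<^sup>+x. ennreal (- ((cmod (f x))\<^sup>2 * ln ((cmod (f x))\<^sup>2))) \<partial>M";
      cases "\<integral>\<^sup>+x. ennreal ((cmod (f x))\<^sup>2 * ln ((cmod (f x))\<^sup>2)) \<partial>M") auto

text \<open>The integral over \<open>Z2\<close> is a two-term sum, so the integral splits into one
  over the even sheet and one over the odd sheet. This reduces the deformed entropy to the two
  single measures.\<close>

lemma nn_integral_nu:
  assumes [measurable]: "F \<in> borel_measurable (borel \<Otimes>\<^sub>M count_space Z2)"
  shows "(\<integral>\<^sup>+x. F x \<partial>nu \<mu>) = (\<integral>\<^sup>+z. F (z, 1) \<partial>nu_e \<mu>) + (\<integral>\<^sup>+z. F (z, -1) \<partial>nu_o \<mu>)"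
proof -
  interpret C: sigma_finite_measure "count_space Z2"
    by (rule sigma_finite_measure_count_space_finite) (simp add: Z2_def)
  define d where "d = (\<lambda>(z, s :: int). ennreal (if s = 1 then nu_e_density \<mu> z else nu_o_density \<mu> z))"
  have [measurable]: "d \<in> borel_measurable (lborel \<Otimes>\<^sub>M count_space Z2)"
    unfolding d_def by measurable
  have [measurable]: "F \<in> borel_measurable (lborel \<Otimes>\<^sub>M count_space Z2)"
    using assms by (simp cong: measurable_cong_sets)
  have [measurable]: "(\<lambda>z. F (z, s)) \<in> borel_measurable borel" if "s \<in> Z2" for s
    using measurable_Pair2[OF assms] that by simp
  have [simp]: "1 \<in> Z2" "-1 \<in> Z2" by (auto simp: Z2_def)
  have "(\<integral>\<^sup>+x. F x \<partial>nu \<mu>) = (\<integral>\<^sup>+z. (\<integral>\<^sup>+s. d (z, s) * F (z, s) \<partial>count_space Z2) \<partial>lborel)"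
    unfolding nu_def d_def[symmetric]
    by (subst nn_integral_density) (auto simp: C.nn_integral_fst[symmetric])
  also have "\<dots> = (\<integral>\<^sup>+z. ennreal (nu_e_density \<mu> z) * F (z, 1) + ennreal (nu_o_density \<mu> z) * F (z, -1) \<partial>lborel)"
    by (intro nn_integral_cong) (simp add: nn_integral_count_space_finite Z2_def d_def add.commute)
  finally show ?thesis
    by (simp add: nn_integral_add nu_e_def nu_o_def nn_integral_density)
qed

section \<open>Estimates for the Macdonald densities\<close>

text \<open>The constant ((\<beta> + 1) / k)^\<beta> comes from ln x \<le> x - 1 at x = k y /
  (\<beta> + 1). Using \<beta> + 1 instead of the optimal \<beta> avoids a division by 0 at \<beta>
  = 0.\<close>

lemma powr_le_exp:
  fixes \<beta> k :: real
  assumes "\<beta> \<ge> 0" "k > 0"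
  obtains C where "C > 0" "\<And>y. y \<ge> 0 \<Longrightarrow> y powr \<beta> \<le> C * exp (k * y)"
proof
  show "exp (\<beta> * ln ((\<beta> + 1) / k)) > 0" by simp
  fix y :: real assume "y \<ge> 0"
  show "y powr \<beta> \<le> exp (\<beta> * ln ((\<beta> + 1) / k)) * exp (k * y)"
  proof (cases "y = 0")
    case False
    with \<open>y \<ge> 0\<close> have y: "y > 0" by simp
    have "ln (y * k / (\<beta> + 1)) \<le> y * k / (\<beta> + 1)"
      using assms y ln_le_minus_one[of "y * k / (\<beta> + 1)"] by simp
    then have "ln y \<le> ln ((\<beta> + 1) / k) + y * k / (\<beta> + 1)"
      using assms y by (simp add: ln_div ln_mult)
    then have "\<beta> * ln y \<le> \<beta> * (ln ((\<beta> + 1) / k) + y * k / (\<beta> + 1))"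
      using assms by (intro mult_left_mono) auto
    also have "\<dots> = \<beta> * ln ((\<beta> + 1) / k) + \<beta> / (\<beta> + 1) * (k * y)"
      by (simp add: algebra_simps)
    also have "\<dots> \<le> \<beta> * ln ((\<beta> + 1) / k) + 1 * (k * y)"
      using assms y by (intro add_left_mono mult_right_mono) auto
    finally show ?thesis
      using y by (simp add: powr_def exp_add[symmetric] mult.commute)
  qed simp
qed

lemma nn_integral_exp_Ici:
  fixes k :: real
  assumes "k > 0"
  shows "(\<integral>\<^sup>+u. ennreal (exp (- k * u)) * indicator {0..} u \<partial>lborel) < \<infinity>"
proof -
  have "(\<integral>\<^sup>+u. ennreal (exp (- k * u)) * indicator {0..} u \<partial>lborel) = ennreal (0 - (- exp (- k * 0) / k))"
  proof (rule nn_integral_FTC_atLeast)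
    have "((\<lambda>u. - exp (- (k * u)) / k) \<longlongrightarrow> 0) at_top"
      using assms by real_asymp
    then show "((\<lambda>u. - exp (- k * u) / k) \<longlongrightarrow> 0) at_top" by simp
  qed (use assms in \<open>auto intro!: derivative_eq_intros\<close>)
  then show ?thesis by simp
qed

lemma cosh_le_exp:
  fixes \<alpha> u :: real
  assumes "u \<ge> 0"
  shows "cosh (\<alpha> * u) \<le> exp (\<bar>\<alpha>\<bar> * u)"
proof -
  have "cosh (\<alpha> * u) = cosh (\<bar>\<alpha>\<bar> * u)"
    using assms cosh_real_abs[of "\<alpha> * u"] by (simp add: abs_mult)
  moreover have "sinh (\<bar>\<alpha>\<bar> * u) \<ge> 0"
    using assms by simp
  ultimately show ?thesis
    using cosh_plus_sinh[of "\<bar>\<alpha>\<bar> * u"] by linarith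
qed

lemma macdonald_integrand_measurable [measurable]:
  "(\<lambda>u. exp (- x * cosh u) * cosh (\<alpha> * u)) \<in> borel_measurable borel" for x \<alpha> :: real
  unfolding cosh_def by measurable

text \<open>An inequality suffices for upper bounds, and it holds for every x: if the integrand is
  not integrable, the left side is 0 by default. Hence z = 0 needs no separate treatment
  later.\<close>

lemma ennreal_macdonald_K_le:
  "ennreal (macdonald_K \<alpha> x)
    \<le> (\<integral>\<^sup>+u. ennreal (exp (- x * cosh u) * cosh (\<alpha> * u)) * indicator {0..} u \<partial>lborel)"
proof -
  let ?g = "\<lambda>u. indicator {0..} u *\<^sub>R (exp (- x * cosh u) * cosh (\<alpha> * u))"
  have "ennreal (LINT u|lborel. ?g u) \<le> (\<integral>\<^sup>+u. ennreal (?g u) \<partial>lborel)"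
  proof (cases "integrable lborel ?g")
    case True
    then show ?thesis
      by (subst nn_integral_eq_integral) auto
  qed (simp add: not_integrable_integral_eq)
  also have "\<dots> = (\<integral>\<^sup>+u. ennreal (exp (- x * cosh u) * cosh (\<alpha> * u)) * indicator {0..} u \<partial>lborel)"
    by (intro nn_integral_cong) (simp split: split_indicator)
  finally show ?thesis by (simp add: macdonald_K_def set_lebesgue_integral_def)
qed

text \<open>Since cosh u \<ge> e^u / 2, the first factor decays doubly exponentially.
  \<open>powr_le_exp\<close> at y = e^u with exponent |\<alpha>| + 1 absorbs e^(|\<alpha>| u) and
  leaves e^(-u) to spare.\<close>

lemma macdonald_integrable:
  fixes x \<alpha> :: real
  assumes "x > 0"
  shows "integrable lborel (\<lambda>u. indicator {0..} u *\<^sub>R (exp (- x * cosh u) * cosh (\<alpha> * u)))"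
proof -
  obtain C where C: "C > 0" "\<And>y. y \<ge> 0 \<Longrightarrow> y powr (\<bar>\<alpha>\<bar> + 1) \<le> C * exp (x / 2 * y)"
    using powr_le_exp[of "\<bar>\<alpha>\<bar> + 1" "x / 2"] assms by auto
  have bd: "exp (- x * cosh u) * cosh (\<alpha> * u) \<le> C * exp (- 1 * u)" if "u \<ge> 0" for u
  proof -
    have "x * (exp u / 2) \<le> x * cosh u"
      using assms by (intro mult_left_mono) (auto simp: cosh_def)
    then have "exp (- x * cosh u) \<le> exp (- (x / 2 * exp u))" by simp
    moreover have "exp ((\<bar>\<alpha>\<bar> + 1) * u) \<le> C * exp (x / 2 * exp u)"
      using C(2)[of "exp u"] by (simp add: powr_def)
    then have "exp (\<bar>\<alpha>\<bar> * u) \<le> C * exp (x / 2 * exp u) * exp (- u)"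
      by (simp add: exp_add exp_minus field_simps)
    ultimately have "exp (- x * cosh u) * cosh (\<alpha> * u)
        \<le> exp (- (x / 2 * exp u)) * (C * exp (x / 2 * exp u) * exp (- u))"
      using cosh_le_exp[OF that, of \<alpha>] by (intro mult_mono) auto
    also have "\<dots> = C * exp (- 1 * u)"
      by (simp add: exp_minus)
    finally show ?thesis .
  qed
  have "(\<integral>\<^sup>+u. ennreal (norm (indicator {0..} u *\<^sub>R (exp (- x * cosh u) * cosh (\<alpha> * u)))) \<partial>lborel)
      \<le> (\<integral>\<^sup>+u. ennreal C * (ennreal (exp (- 1 * u)) * indicator {0..} u) \<partial>lborel)"
    using bd C(1)
    by (intro nn_integral_mono) (auto simp: ennreal_mult'[symmetric] split: split_indicator intro!: ennreal_leI)
  also have "\<dots> < \<infinity>"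
    using nn_integral_exp_Ici[of 1] by (simp add: nn_integral_cmult ennreal_mult_less_top)
  finally show ?thesis
    by (rule integrableI_bounded[rotated]) measurable
qed

text \<open>Only u in [0, 1] is kept, where cosh u \<le> cosh 1 and cosh (\<alpha> u) \<ge> 1. The
  crude rate cosh 1 is enough, as any Gaussian lower bound on the density serves the growth
  estimate.\<close>

lemma macdonald_K_ge:
  assumes "x > 0"
  shows "macdonald_K \<alpha> x \<ge> exp (- (cosh 1 * x))"
proof -
  have "exp (- (cosh 1 * x)) = (LINT u|lborel. indicator {0..1::real} u *\<^sub>R exp (- (cosh 1 * x)))"
    by simp
  also have "\<dots> \<le> (LINT u|lborel. indicator {0..} u *\<^sub>R (exp (- x * cosh u) * cosh (\<alpha> * u)))"
  proof (rule integral_mono)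
    show "integrable lborel (\<lambda>u. indicator {0..} u *\<^sub>R (exp (- x * cosh u) * cosh (\<alpha> * u)))"
      by (rule macdonald_integrable[OF assms])
    fix u :: real
    have "exp (- (cosh 1 * x)) \<le> exp (- x * cosh u) * cosh (\<alpha> * u)" if "0 \<le> u" "u \<le> 1"
    proof -
      have "cosh u \<le> cosh 1" using that cosh_real_nonneg_le_iff by auto
      then have "exp (- (cosh 1 * x)) * 1 \<le> exp (- x * cosh u) * cosh (\<alpha> * u)"
        using assms by (intro mult_mono) (auto simp: cosh_real_ge_1)
      then show ?thesis by simp
    qed
    then show "indicator {0..1::real} u *\<^sub>R exp (- (cosh 1 * x))
        \<le> indicator {0..} u *\<^sub>R (exp (- x * cosh u) * cosh (\<alpha> * u))"
      by (auto split: split_indicator)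
  qed (auto intro!: integrable_mult_left)
  finally show ?thesis by (simp add: macdonald_K_def set_lebesgue_integral_def)
qed


section \<open>Gaussian moments in the plane and the exponential moment of the Macdonald
  kernel\<close>

lemma gauss_integral_scale:
  fixes p a :: real
  assumes "a > 0"
  shows "(\<integral>\<^sup>+z. ennreal (exp (- a * (cmod z)\<^sup>2) * cmod z powr p) \<partial>lborel)
    = ennreal (a powr (- (p / 2 + 1))) * (\<integral>\<^sup>+z. ennreal (exp (- (cmod z)\<^sup>2) * cmod z powr p) \<partial>lborel)"
proof -
  \<comment> \<open>The substitution z -> k z turns a |z|^2 into |z|^2. Its Jacobian is k^2 because
    the plane has real dimension 2; together with k^p this is a^(-(p/2 + 1)).\<close>
  define k where "k = a powr (- 1 / 2)"
  have k: "k > 0" using assms by (simp add: k_def)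
  have k2: "k\<^sup>2 = a powr (- 1)"
    using assms by (simp add: k_def powr_power)
  have kp: "k\<^sup>2 * k powr p = a powr (- (p / 2 + 1))"
    using assms unfolding k2 by (simp add: k_def powr_powr powr_diff)
  have "(\<integral>\<^sup>+z. ennreal (exp (- a * (cmod z)\<^sup>2) * cmod z powr p) \<partial>lborel)
      = (\<integral>\<^sup>+z. ennreal (exp (- a * (cmod z)\<^sup>2) * cmod z powr p)
          \<partial>density (distr lborel borel (\<lambda>x::complex. 0 + k *\<^sub>R x)) (\<lambda>_. \<bar>k\<bar> ^ DIM(complex)))"
    using lborel_affine[of k "0::complex"] k by simp
  also have "\<dots> = (\<integral>\<^sup>+z. ennreal (k\<^sup>2) * ennreal (exp (- a * (cmod (k *\<^sub>R z))\<^sup>2) * cmod (k *\<^sub>R z) powr p) \<partial>lborel)"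
    using k by (simp add: nn_integral_density nn_integral_distr)
  also have "\<dots> = (\<integral>\<^sup>+z. ennreal (a powr (- (p / 2 + 1))) * ennreal (exp (- (cmod z)\<^sup>2) * cmod z powr p) \<partial>lborel)"
  proof (rule nn_integral_cong)
    fix z :: complex
    have "a * (k * cmod z)\<^sup>2 = (cmod z)\<^sup>2"
      using assms by (simp add: power_mult_distrib k2 powr_minus)
    then show "ennreal (k\<^sup>2) * ennreal (exp (- a * (cmod (k *\<^sub>R z))\<^sup>2) * cmod (k *\<^sub>R z) powr p)
        = ennreal (a powr (- (p / 2 + 1))) * ennreal (exp (- (cmod z)\<^sup>2) * cmod z powr p)"
      using k unfolding kp[symmetric]
      by (simp add: ennreal_mult'[symmetric] powr_mult mult_ac)
  qed
  also have "\<dots> = ennreal (a powr (- (p / 2 + 1))) * (\<integral>\<^sup>+z. ennreal (exp (- (cmod z)\<^sup>2) * cmod z powr p) \<partial>lborel)"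
    by (rule nn_integral_cmult) measurable
  finally show ?thesis .
qed

text \<open>Half of the Gaussian absorbs |z|^p; the other half factors over the real and imaginary
  parts into two integrals of e^(-x^2/2), a multiple of the standard normal density.\<close>

lemma gauss_integral_finite:
  fixes p :: real
  assumes "p \<ge> 0"
  shows "(\<integral>\<^sup>+z. ennreal (exp (- (cmod z)\<^sup>2) * cmod z powr p) \<partial>lborel) < \<infinity>"
proof -
  obtain C where C: "C > 0" "\<And>y. y \<ge> 0 \<Longrightarrow> y powr (p / 2) \<le> C * exp (1 / 2 * y)"
    using powr_le_exp[of "p / 2" "1 / 2"] assms by auto
  have g: "(\<integral>\<^sup>+x. ennreal (exp (- x\<^sup>2 / 2)) \<partial>lborel) < \<infinity>"
  proof -
    have "integrable lborel (\<lambda>x. sqrt (2 * pi) * std_normal_density x)"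
      using integrable_normal_density[of 1 0] by (intro integrable_mult_right) auto
    then have "integrable lborel (\<lambda>x::real. exp (- x\<^sup>2 / 2))"
      by (simp add: std_normal_density_def)
    then show ?thesis by (simp add: integrable_iff_bounded)
  qed
  have "(\<integral>\<^sup>+z. ennreal (exp (- (cmod z)\<^sup>2) * cmod z powr p) \<partial>lborel)
      \<le> (\<integral>\<^sup>+z. ennreal C * (\<Prod>b\<in>(Basis::complex set). ennreal (exp (- (z \<bullet> b)\<^sup>2 / 2))) \<partial>lborel)"
  proof (rule nn_integral_mono)
    fix z :: complex
    have "cmod z powr p = ((cmod z)\<^sup>2) powr (p / 2)"
      by (simp add: powr_powr flip: powr_numeral)
    also have "\<dots> \<le> C * exp (1 / 2 * (cmod z)\<^sup>2)"
      by (rule C(2)) simp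
    finally have "exp (- (cmod z)\<^sup>2) * cmod z powr p \<le> exp (- (cmod z)\<^sup>2) * (C * exp (1 / 2 * (cmod z)\<^sup>2))"
      by (intro mult_left_mono) auto
    also have "\<dots> = C * (exp (- (Re z)\<^sup>2 / 2) * exp (- (Im z)\<^sup>2 / 2))"
      by (simp add: exp_add[symmetric] cmod_power2 field_simps)
    finally show "ennreal (exp (- (cmod z)\<^sup>2) * cmod z powr p)
        \<le> ennreal C * (\<Prod>b\<in>Basis. ennreal (exp (- (z \<bullet> b)\<^sup>2 / 2)))"
      using C(1) by (simp add: Basis_complex_def ennreal_mult'[symmetric] ennreal_leI)
  qed
  also have "\<dots> = ennreal C * (\<Prod>b\<in>(Basis::complex set). \<integral>\<^sup>+x. ennreal (exp (- x\<^sup>2 / 2)) \<partial>lborel)"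
    by (subst nn_integral_cmult, measurable)
       (subst nn_integral_lborel_prod[of "\<lambda>_ x. ennreal (exp (- x\<^sup>2 / 2))"], auto)
  also have "\<dots> < \<infinity>"
    using g by (simp add: Basis_complex_def ennreal_mult_less_top power2_eq_square)
  finally show ?thesis .
qed

lemma macdonald_exp_moment:
  fixes \<alpha> p :: real
  assumes p: "p \<ge> 0" and \<alpha>: "\<bar>\<alpha>\<bar> < p / 2 + 1"
  shows "(\<integral>\<^sup>+z. ennreal (exp ((cmod z)\<^sup>2 / 2) * (macdonald_K \<alpha> ((cmod z)\<^sup>2) * cmod z powr p)) \<partial>lborel) < \<infinity>"
proof -
  \<comment> \<open>The exponent produced by scaling: the z-integral at fixed u is G (cosh u -
    1/2)^(-q).\<close>
  define q where "q = p / 2 + 1"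
  define G where "G = (\<integral>\<^sup>+z. ennreal (exp (- (cmod z)\<^sup>2) * cmod z powr p) \<partial>lborel)"
  have G: "G < \<infinity>" unfolding G_def by (rule gauss_integral_finite[OF p])
  have "(\<integral>\<^sup>+z. ennreal (exp ((cmod z)\<^sup>2 / 2) * (macdonald_K \<alpha> ((cmod z)\<^sup>2) * cmod z powr p)) \<partial>lborel)
    \<le> (\<integral>\<^sup>+z. (\<integral>\<^sup>+u. ennreal (exp (- (cosh u - 1 / 2) * (cmod z)\<^sup>2) * cmod z powr p)
          * (ennreal (cosh (\<alpha> * u)) * indicator {0..} u) \<partial>lborel) \<partial>lborel)"
  proof (rule nn_integral_mono)
    fix z :: complex
    have "ennreal (exp ((cmod z)\<^sup>2 / 2) * (macdonald_K \<alpha> ((cmod z)\<^sup>2) * cmod z powr p))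
       = ennreal (exp ((cmod z)\<^sup>2 / 2) * cmod z powr p) * ennreal (macdonald_K \<alpha> ((cmod z)\<^sup>2))"
      by (subst ennreal_mult'[symmetric]) (auto simp: mult_ac)
    also have "\<dots> \<le> ennreal (exp ((cmod z)\<^sup>2 / 2) * cmod z powr p) *
        (\<integral>\<^sup>+u. ennreal (exp (- (cmod z)\<^sup>2 * cosh u) * cosh (\<alpha> * u)) * indicator {0..} u \<partial>lborel)"
      by (intro mult_left_mono ennreal_macdonald_K_le) simp
    also have "\<dots> = (\<integral>\<^sup>+u. ennreal (exp ((cmod z)\<^sup>2 / 2) * cmod z powr p) *
        (ennreal (exp (- (cmod z)\<^sup>2 * cosh u) * cosh (\<alpha> * u)) * indicator {0..} u) \<partial>lborel)"
      by (rule nn_integral_cmult[symmetric]) measurable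
    also have "\<dots> = (\<integral>\<^sup>+u. ennreal (exp (- (cosh u - 1 / 2) * (cmod z)\<^sup>2) * cmod z powr p)
          * (ennreal (cosh (\<alpha> * u)) * indicator {0..} u) \<partial>lborel)"
    proof (rule nn_integral_cong)
      fix u :: real
      have "exp (- (cosh u - 1 / 2) * (cmod z)\<^sup>2) = exp ((cmod z)\<^sup>2 / 2) * exp (- (cmod z)\<^sup>2 * cosh u)"
        unfolding exp_add[symmetric] by (simp add: algebra_simps)
      then show "ennreal (exp ((cmod z)\<^sup>2 / 2) * cmod z powr p) *
          (ennreal (exp (- (cmod z)\<^sup>2 * cosh u) * cosh (\<alpha> * u)) * indicator {0..} u)
        = ennreal (exp (- (cosh u - 1 / 2) * (cmod z)\<^sup>2) * cmod z powr p)
          * (ennreal (cosh (\<alpha> * u)) * indicator {0..} u)"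
        by (simp add: ennreal_mult' mult_ac)
    qed
    finally show "ennreal (exp ((cmod z)\<^sup>2 / 2) * (macdonald_K \<alpha> ((cmod z)\<^sup>2) * cmod z powr p)) \<le> \<dots>" .
  qed
  also have "\<dots> = (\<integral>\<^sup>+u. (\<integral>\<^sup>+z. ennreal (exp (- (cosh u - 1 / 2) * (cmod z)\<^sup>2) * cmod z powr p)
          * (ennreal (cosh (\<alpha> * u)) * indicator {0..} u) \<partial>lborel) \<partial>lborel)"
    unfolding cosh_def by (rule lborel_pair.Fubini') measurable
  also have "\<dots> \<le> (\<integral>\<^sup>+u. (ennreal (4 powr q) * G) * (ennreal (exp (- (q - \<bar>\<alpha>\<bar>) * u)) * indicator {0..} u) \<partial>lborel)"
  proof (rule nn_integral_mono)
    fix u :: real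
    define a where "a = cosh u - 1 / 2"
    \<comment> \<open>The target cosh u - 1/2 \<ge> e^u / 4 is equivalent to e^u + 2 e^(-u) \<ge> 2,
      which follows from cosh u \<ge> 1.\<close>
    have "2 \<le> exp u + exp (- u)"
      using cosh_real_ge_1[of u] by (simp add: cosh_field_def)
    then have "2 \<le> exp u + 2 * exp (- u)"
      by (rule order_trans) simp
    then have "a \<ge> exp u / 4"
      by (simp add: a_def cosh_field_def field_simps)
    then have a: "a > 0" "a \<ge> exp u / 4"
      by (auto intro: less_le_trans[of _ "exp u / 4"])
    have "(\<integral>\<^sup>+z. ennreal (exp (- a * (cmod z)\<^sup>2) * cmod z powr p)
          * (ennreal (cosh (\<alpha> * u)) * indicator {0..} u) \<partial>lborel)
        = ennreal (a powr (- q)) * G * (ennreal (cosh (\<alpha> * u)) * indicator {0..} u)"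
      using gauss_integral_scale[OF a(1), of p]
      by (simp add: nn_integral_multc q_def G_def)
    also have "\<dots> \<le> (ennreal (4 powr q) * G) * (ennreal (exp (- (q - \<bar>\<alpha>\<bar>) * u)) * indicator {0..} u)"
    proof (cases "u \<ge> 0")
      case True
      \<comment> \<open>A negative exponent reverses the bound on a. Against cosh (\<alpha> u) \<le>
        e^(|\<alpha>| u) this leaves the decay rate q - |\<alpha>|, positive by hypothesis.\<close>
      have "a powr (- q) \<le> (exp u / 4) powr (- q)"
        using a p by (intro powr_mono2') (auto simp: q_def)
      also have "\<dots> = 4 powr q * exp (- q * u)"
        by (simp add: powr_def ln_div exp_add[symmetric] algebra_simps)
      finally have "a powr (- q) * cosh (\<alpha> * u) \<le> (4 powr q * exp (- q * u)) * exp (\<bar>\<alpha>\<bar> * u)"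
        using cosh_le_exp[OF True, of \<alpha>] by (intro mult_mono) auto
      also have "\<dots> = 4 powr q * exp (- (q - \<bar>\<alpha>\<bar>) * u)"
        by (simp add: exp_add[symmetric] algebra_simps)
      finally have "ennreal (a powr (- q)) * ennreal (cosh (\<alpha> * u))
          \<le> ennreal (4 powr q) * ennreal (exp (- (q - \<bar>\<alpha>\<bar>) * u))"
        by (simp add: ennreal_mult'[symmetric] ennreal_leI)
      from mult_right_mono[OF this, of G] True show ?thesis
        by (simp add: mult_ac)
    qed simp
    finally show "(\<integral>\<^sup>+z. ennreal (exp (- (cosh u - 1 / 2) * (cmod z)\<^sup>2) * cmod z powr p)
          * (ennreal (cosh (\<alpha> * u)) * indicator {0..} u) \<partial>lborel)
        \<le> (ennreal (4 powr q) * G) * (ennreal (exp (- (q - \<bar>\<alpha>\<bar>) * u)) * indicator {0..} u)"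
      unfolding a_def .
  qed
  also have "\<dots> = (ennreal (4 powr q) * G) * (\<integral>\<^sup>+u. ennreal (exp (- (q - \<bar>\<alpha>\<bar>) * u)) * indicator {0..} u \<partial>lborel)"
    by (rule nn_integral_cmult) measurable
  also have "\<dots> < \<infinity>"
    using nn_integral_exp_Ici[of "q - \<bar>\<alpha>\<bar>"] \<alpha> G by (simp add: q_def ennreal_mult_less_top)
  finally show ?thesis .
qed

text \<open>One statement for both measures, with \<alpha> = \<mu> - 1/2 or \<mu> + 1/2. The
  condition on |\<alpha>| is that of the exponential moment at p = 2 \<mu> + 1, and \<mu> > -1/2
  ensures p \<ge> 0 and a positive Gamma factor.\<close>

lemma macdonald_entropy_energy_iff:
  fixes \<mu> \<alpha> :: real
  defines "\<rho> \<equiv> \<lambda>z. 2 powr (1/2 - \<mu>) / (pi * Gamma (\<mu> + 1/2))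
       * macdonald_K \<alpha> ((cmod z)\<^sup>2) * cmod z powr (2 * \<mu> + 1)"
  defines "M \<equiv> density lborel (\<lambda>z. ennreal (\<rho> z))"
  assumes \<mu>: "\<mu> > - 1/2" and \<alpha>: "\<bar>\<alpha>\<bar> < \<mu> + 3/2"
    and f: "f holomorphic_on UNIV"
    and L2: "integrable M (\<lambda>z. (cmod (f z))\<^sup>2)"
  shows "(\<integral>\<^sup>+z. ennreal (- ((cmod (f z))\<^sup>2 * ln ((cmod (f z))\<^sup>2))) \<partial>M) < \<infinity>"
    and "(\<integral>\<^sup>+z. ennreal ((cmod (f z))\<^sup>2 * ln ((cmod (f z))\<^sup>2)) \<partial>M) < \<infinity>
      \<longleftrightarrow> (\<integral>\<^sup>+z. ennreal ((cmod z)\<^sup>2 * (cmod (f z))\<^sup>2) \<partial>M) < \<infinity>"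
proof -
  define c where "c = 2 powr (1/2 - \<mu>) / (pi * Gamma (\<mu> + 1/2))"
  have c: "c > 0" using \<mu> by (simp add: c_def Gamma_real_pos)
  have [measurable]: "\<rho> \<in> borel_measurable borel"
    unfolding \<rho>_def by measurable
  \<comment> \<open>For |w| \<ge> 1 the power factor is at least 1, so the lower bound on the
    Macdonald function passes to \<rho> with b = cosh 1.\<close>
  have low: "\<rho> w \<ge> c * exp (- cosh 1 * (cmod w)\<^sup>2)" if w: "cmod w \<ge> 1" for w
  proof -
    have "exp (- (cosh 1 * (cmod w)\<^sup>2)) \<le> macdonald_K \<alpha> ((cmod w)\<^sup>2)"
      using w by (intro macdonald_K_ge) (auto intro!: zero_less_power)
    moreover have "1 \<le> cmod w powr (2 * \<mu> + 1)"
      using w \<mu> by (intro ge_one_powr_ge_zero) auto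
    ultimately have "c * (exp (- (cosh 1 * (cmod w)\<^sup>2)) * 1)
        \<le> c * (macdonald_K \<alpha> ((cmod w)\<^sup>2) * cmod w powr (2 * \<mu> + 1))"
      using c by (intro mult_left_mono mult_mono) (auto intro: order_trans[OF exp_ge_zero])
    then show ?thesis by (simp add: \<rho>_def c_def mult.assoc)
  qed
  have "(\<integral>\<^sup>+z. ennreal (exp ((cmod z)\<^sup>2 / 2)) \<partial>M)
      = (\<integral>\<^sup>+z. ennreal c * ennreal (exp ((cmod z)\<^sup>2 / 2) *
          (macdonald_K \<alpha> ((cmod z)\<^sup>2) * cmod z powr (2 * \<mu> + 1))) \<partial>lborel)"
    unfolding M_def using c
    by (subst nn_integral_density)
       (auto intro!: nn_integral_cong simp: \<rho>_def c_def[symmetric] ennreal_mult'[symmetric]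
         ennreal_mult''[symmetric] mult_ac)
  also have "\<dots> < \<infinity>"
    using macdonald_exp_moment[of "2 * \<mu> + 1" \<alpha>] \<mu> \<alpha>
    by (simp add: nn_integral_cmult ennreal_mult_less_top add_divide_distrib)
  finally have expo: "(\<integral>\<^sup>+z. ennreal (exp ((cmod z)\<^sup>2 / 2)) \<partial>M) < \<infinity>" .
  have b: "cosh (1::real) \<ge> 0" by simp
  note * = entropy_energy_iff[where \<rho>=\<rho> and b="cosh 1", OF f _ _ c b low, folded M_def, OF L2 _ _ expo]
  show "(\<integral>\<^sup>+z. ennreal (- ((cmod (f z))\<^sup>2 * ln ((cmod (f z))\<^sup>2))) \<partial>M) < \<infinity>"
    by (rule *(1)) auto
  show "(\<integral>\<^sup>+z. ennreal ((cmod (f z))\<^sup>2 * ln ((cmod (f z))\<^sup>2)) \<partial>M) < \<infinity>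
      \<longleftrightarrow> (\<integral>\<^sup>+z. ennreal ((cmod z)\<^sup>2 * (cmod (f z))\<^sup>2) \<partial>M) < \<infinity>"
    by (rule *(2)) auto
qed

section \<open>Specialization to the even and odd measures, and the three equivalences\<close>

lemma nu_e_entropy_energy_iff:
  assumes \<mu>: "\<mu> > - 1/2" and g: "g holomorphic_on UNIV" "g \<in> L2_space (nu_e \<mu>)"
  shows "(\<integral>\<^sup>+z. ennreal (- ((cmod (g z))\<^sup>2 * ln ((cmod (g z))\<^sup>2))) \<partial>nu_e \<mu>) < \<infinity>"
    and "(\<integral>\<^sup>+z. ennreal ((cmod (g z))\<^sup>2 * ln ((cmod (g z))\<^sup>2)) \<partial>nu_e \<mu>) < \<infinity> \<longleftrightarrow> energy_e \<mu> g < \<infinity>"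
  using macdonald_entropy_energy_iff[OF \<mu>, of "\<mu> - 1/2" g] assms
  unfolding energy_e_def nu_e_def nu_e_density_def L2_space_def by auto

lemma nu_o_entropy_energy_iff:
  assumes \<mu>: "\<mu> > - 1/2" and g: "g holomorphic_on UNIV" "g \<in> L2_space (nu_o \<mu>)"
  shows "(\<integral>\<^sup>+z. ennreal (- ((cmod (g z))\<^sup>2 * ln ((cmod (g z))\<^sup>2))) \<partial>nu_o \<mu>) < \<infinity>"
    and "(\<integral>\<^sup>+z. ennreal ((cmod (g z))\<^sup>2 * ln ((cmod (g z))\<^sup>2)) \<partial>nu_o \<mu>) < \<infinity> \<longleftrightarrow> energy_o \<mu> g < \<infinity>"
  using macdonald_entropy_energy_iff[OF \<mu>, of "\<mu> + 1/2" g] assms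
  unfolding energy_o_def nu_o_def nu_o_density_def L2_space_def by auto

lemma holomorphic_parts:
  assumes f: "f holomorphic_on UNIV"
  shows "even_part f holomorphic_on UNIV" "odd_part f holomorphic_on UNIV"
proof -
  have "(\<lambda>z. f (- z)) holomorphic_on UNIV"
    by (rule holomorphic_on_compose[of uminus UNIV f, unfolded o_def])
       (auto intro!: holomorphic_intros holomorphic_on_subset[OF f])
  then show "even_part f holomorphic_on UNIV" "odd_part f holomorphic_on UNIV"
    using f unfolding even_part_def[abs_def] odd_part_def[abs_def] by (auto intro!: holomorphic_intros)
qed

theorem corollary4p1:
  fixes \<mu> :: real
  assumes "\<mu> > - 1/2"
  shows "(\<forall>f \<in> Bargmann_e \<mu>. \<bar>L2_entropy (nu_e \<mu>) f\<bar> \<noteq> \<infinity> \<longleftrightarrow> energy_e \<mu> f < \<infinity>) \<and>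
         (\<forall>f \<in> Bargmann_o \<mu>. \<bar>L2_entropy (nu_o \<mu>) f\<bar> \<noteq> \<infinity> \<longleftrightarrow> energy_o \<mu> f < \<infinity>) \<and>
         (\<forall>f \<in> Bargmann \<mu>. \<bar>deformed_entropy \<mu> f\<bar> \<noteq> \<infinity> \<longleftrightarrow> deformed_energy \<mu> f < \<infinity>)"
proof (intro conjI ballI)
  fix f assume "f \<in> Bargmann_e \<mu>"
  \<comment> \<open>An even function is its own even part, so the condition on
    \<open>even_part f\<close> in the definition of \<open>Bargmann\<close> becomes square
    integrability of f itself.\<close>
  moreover from this have "even_part f = f"
    by (auto simp: Bargmann_e_def even_part_def)
  ultimately have f: "f holomorphic_on UNIV" "f \<in> L2_space (nu_e \<mu>)"
    by (auto simp: Bargmann_e_def Bargmann_def)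
  show "\<bar>L2_entropy (nu_e \<mu>) f\<bar> \<noteq> \<infinity> \<longleftrightarrow> energy_e \<mu> f < \<infinity>"
    by (simp only: L2_entropy_finite_iff[OF nu_e_entropy_energy_iff(1)[OF assms f]]
        nu_e_entropy_energy_iff(2)[OF assms f])
next
  fix f assume "f \<in> Bargmann_o \<mu>"
  moreover from this have "odd_part f = f"
    by (auto simp: Bargmann_o_def odd_part_def)
  ultimately have f: "f holomorphic_on UNIV" "f \<in> L2_space (nu_o \<mu>)"
    by (auto simp: Bargmann_o_def Bargmann_def)
  show "\<bar>L2_entropy (nu_o \<mu>) f\<bar> \<noteq> \<infinity> \<longleftrightarrow> energy_o \<mu> f < \<infinity>"
    by (simp only: L2_entropy_finite_iff[OF nu_o_entropy_energy_iff(1)[OF assms f]]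
        nu_o_entropy_energy_iff(2)[OF assms f])
next
  fix f assume f: "f \<in> Bargmann \<mu>"
  define h where "h = (\<lambda>(z, s :: int). if s = 1 then even_part f z else odd_part f z)"
  have parts: "even_part f holomorphic_on UNIV" "even_part f \<in> L2_space (nu_e \<mu>)"
      "odd_part f holomorphic_on UNIV" "odd_part f \<in> L2_space (nu_o \<mu>)"
    using f by (auto simp: Bargmann_def holomorphic_parts)
  have [measurable]: "even_part f \<in> borel_measurable borel" "odd_part f \<in> borel_measurable borel"
    using parts by (auto intro!: borel_measurable_continuous_onI holomorphic_on_imp_continuous_on)
  have [measurable]: "h \<in> borel_measurable (borel \<Otimes>\<^sub>M count_space Z2)"
    unfolding h_def by measurable
  note e = nu_e_entropy_energy_iff[OF assms parts(1,2)]
  note o = nu_o_entropy_energy_iff[OF assms parts(3,4)]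
  \<comment> \<open>The negative part on the doubled plane is the sum of the two finite negative
    parts.\<close>
  have "(\<integral>\<^sup>+x. ennreal (- ((cmod (h x))\<^sup>2 * ln ((cmod (h x))\<^sup>2))) \<partial>nu \<mu>) < \<infinity>"
    using e(1) o(1) by (subst nn_integral_nu) (auto simp: h_def)
  then have "\<bar>deformed_entropy \<mu> f\<bar> \<noteq> \<infinity>
      \<longleftrightarrow> (\<integral>\<^sup>+x. ennreal ((cmod (h x))\<^sup>2 * ln ((cmod (h x))\<^sup>2)) \<partial>nu \<mu>) < \<infinity>"
    unfolding deformed_entropy_def h_def[symmetric] by (rule L2_entropy_finite_iff)
  \<comment> \<open>A sum in [0, \<infinity>] is finite exactly when both summands are, on the
    entropy side as on the energy side.\<close>
  also have "\<dots> \<longleftrightarrow> deformed_energy \<mu> f < \<infinity>"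
    using e(2) o(2) unfolding deformed_energy_def
    by (subst nn_integral_nu) (auto simp: h_def)
  finally show "\<bar>deformed_entropy \<mu> f\<bar> \<noteq> \<infinity> \<longleftrightarrow> deformed_energy \<mu> f < \<infinity>" .
qed

end
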